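(* Let $\mathbb{X}=\ell_p^n$ (over $\mathbb{R}$), where $1<p<\infty$ and $n\in\mathbb{N}$. Then $p=2$ (i.e. $\mathbb{X}$ is a Hilbert space) if and only if for each $\epsilon>0$ and for each isometry $T$ on $\mathbb{X}$, $T$ has a non-trivial uniform $\epsilon$-BPB approximation which is also an isometry.
   Context: An isometry on $\mathbb{X}$ is a linear isometry from $\mathbb{X}$ to $\mathbb{X}$. $\mathbb{L}(\mathbb{X},\mathbb{X})$ is the space of bounded linear operators on $\mathbb{X}$ with the operator norm; $S_Z$ is the unit sphere of a normed space $Z$; for an operator $A$, $M_A=\{x\in S_{\mathbb{X}}:\|Ax\|=\|A\|\}$. For $T\in S_{\mathbb{L}(\mathbb{X},\mathbb{X})}$ and $\epsilon>0$, an operator $A\in S_{\mathbb{L}(\mathbb{X},\mathbb{X})}$ is a uniform $\epsilon$-BPB approximation of $T$ if $\|T-A\|<\epsilon$ and there exists $\delta(\epsilon)>0$ such that for each $x_0\in S_{\mathbb{X}}$ with $\|Tx_0\|>1-\delta(\epsilon)$ there exists $u_0\in M_A$ with $\|u_0-x_0\|<\epsilon$. It is non-trivial if in addition $A\neq T$.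
   Formalization: The dimension n is assumed to be at least 2; for n = 1 and p = 2 the claim is false, since the only isometries of the real line are id and −id, which are at distance 2, so id has no non-trivial isometric approximation for ε ≤ 2. *)

theory Defs
  imports "HOL-Analysis.Analysis"
begin

text \<open>
  The exponent \<open>p\<close> is a real variable, so the norm of \<open>\<ell>\<^sub>p\<^sup>n\<close> cannot be a type class instance on
  \<^typ>\<open>real^'n\<close>.  The notions below therefore take the norm \<open>N\<close> of the space as an explicit
  argument; each is the library notion for normed spaces with \<^const>\<open>norm\<close> replaced by \<open>N\<close>.
\<close>

definition lp_norm :: "real \<Rightarrow> real ^ 'n \<Rightarrow> real" where
  "lp_norm p x = (\<Sum>i\<in>UNIV. \<bar>x $ i\<bar> powr p) powr (1 / p)"

definition unit_sphere :: "('a \<Rightarrow> real) \<Rightarrow> 'a set" where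
  "unit_sphere N = {x. N x = 1}"

text \<open>Compare \<^const>\<open>bounded_linear\<close> and \<^const>\<open>onorm\<close>.\<close>

definition bounded_operator :: "('a::real_vector \<Rightarrow> real) \<Rightarrow> ('a \<Rightarrow> 'a) \<Rightarrow> bool" where
  "bounded_operator N A \<longleftrightarrow> linear A \<and> (\<exists>K. \<forall>x. N (A x) \<le> N x * K)"

definition operator_norm :: "('a \<Rightarrow> real) \<Rightarrow> ('a \<Rightarrow> 'a) \<Rightarrow> real" where
  "operator_norm N A = (SUP x. N (A x) / N x)"

definition operator_sphere :: "('a::real_vector \<Rightarrow> real) \<Rightarrow> ('a \<Rightarrow> 'a) set" where
  "operator_sphere N = {A. bounded_operator N A \<and> operator_norm N A = 1}"

definition norm_attainment_set :: "('a \<Rightarrow> real) \<Rightarrow> ('a \<Rightarrow> 'a) \<Rightarrow> 'a set" where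
  "norm_attainment_set N A = {x \<in> unit_sphere N. N (A x) = operator_norm N A}"

definition isometry_on_space :: "('a::real_vector \<Rightarrow> real) \<Rightarrow> ('a \<Rightarrow> 'a) \<Rightarrow> bool" where
  "isometry_on_space N T \<longleftrightarrow> linear T \<and> (\<forall>x. N (T x) = N x)"

definition uniform_BPB_approx ::
    "('a::real_vector \<Rightarrow> real) \<Rightarrow> real \<Rightarrow> ('a \<Rightarrow> 'a) \<Rightarrow> ('a \<Rightarrow> 'a) \<Rightarrow> bool" where
  "uniform_BPB_approx N \<epsilon> T A \<longleftrightarrow>
     T \<in> operator_sphere N \<and> A \<in> operator_sphere N \<and>
     operator_norm N (\<lambda>x. T x - A x) < \<epsilon> \<and>
     (\<exists>\<delta>>0. \<forall>x\<^sub>0 \<in> unit_sphere N. N (T x\<^sub>0) > 1 - \<delta> \<longrightarrow>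
        (\<exists>u\<^sub>0 \<in> norm_attainment_set N A. N (u\<^sub>0 - x\<^sub>0) < \<epsilon>))"

definition nontrivial_uniform_BPB_approx ::
    "('a::real_vector \<Rightarrow> real) \<Rightarrow> real \<Rightarrow> ('a \<Rightarrow> 'a) \<Rightarrow> ('a \<Rightarrow> 'a) \<Rightarrow> bool" where
  "nontrivial_uniform_BPB_approx N \<epsilon> T A \<longleftrightarrow> uniform_BPB_approx N \<epsilon> T A \<and> A \<noteq> T"

end

theory Submission
  imports Defs
begin

text \<open>
  For \<open>p = 2\<close>, composing \<open>T\<close> with a small rotation of a coordinate plane gives a different isometry
  as close to \<open>T\<close> as desired, and the norm attainment set of an isometry is the whole unit sphere.
  For \<open>p \<noteq> 2\<close> the identity is an isolated isometry: the \<open>p\<close>-th powers of the norms of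
  \<open>e\<^sub>i + e\<^sub>j\<close>, \<open>e\<^sub>i - e\<^sub>j\<close>, \<open>e\<^sub>i\<close>, \<open>e\<^sub>j\<close> and the strict scalar Clarkson inequality show
  that the images of different basis vectors under an isometry have disjoint supports. If the
  isometry is close to the identity, its diagonal entries are positive, so it is the identity.
\<close>

section \<open>The scalar Clarkson inequality\<close>

lemma powr_midpoint_le:
  fixes s x y :: real
  assumes "1 < s" "0 \<le> x" "0 \<le> y"
  shows "2 * ((x + y) / 2) powr s \<le> x powr s + y powr s"
proof (cases "x = 0 \<or> y = 0")
  case True
  \<comment> \<open>Convexity is applied on the open half-line, so a zero argument is treated apart:
    there the claim is 2 (z/2)^s \<le> z^s, which amounts to 2 \<le> 2^s.\<close>
  have "2 powr 1 \<le> (2::real) powr s"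
    using assms by (intro powr_mono) auto
  then have "2 * (z / 2) powr s \<le> z powr s" if "0 \<le> z" for z :: real
    using that mult_right_mono[of 2 "2 powr s" "z powr s"] by (simp add: powr_divide field_simps)
  with True assms show ?thesis by auto
next
  case False
  have "convex_on {0<..} (\<lambda>x::real. x powr s)"
    using assms by (intro powr_convex) auto
  from convex_onD[OF this, of "1/2" x y] False assms show ?thesis
    by (simp add: field_simps)
qed

text \<open>Midpoint convexity for the exponent 1/s > 1, applied to x^s and y^s and then raised to
  the power s.\<close>

lemma powr_midpoint_ge:
  fixes s x y :: real
  assumes "0 < s" "s < 1" "0 \<le> x" "0 \<le> y"
  shows "x powr s + y powr s \<le> 2 * ((x + y) / 2) powr s"
proof -
  let ?m = "(x powr s + y powr s) / 2"
  have "2 * ?m powr (1 / s) \<le> (x powr s) powr (1 / s) + (y powr s) powr (1 / s)"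
    using assms by (intro powr_midpoint_le) auto
  also have "\<dots> = x + y" using assms by (simp add: powr_powr)
  finally have "(?m powr (1 / s)) powr s \<le> ((x + y) / 2) powr s"
    using assms by (intro powr_mono2) auto
  then show ?thesis using assms by (simp add: powr_powr)
qed

text \<open>Split z^s = z * z^(s-1) for z = x and z = y. As s - 1 > 0, the second factor grows
  strictly when its base becomes x + y; the two bounds are added.\<close>

lemma powr_superadditive:
  fixes s x y :: real
  assumes "1 < s" "0 < x" "0 < y"
  shows "x powr s + y powr s < (x + y) powr s"
proof -
  have "z powr s < z * (x + y) powr (s - 1)" if "0 < z" "z < x + y" for z
  proof -
    have "z powr s = z * z powr (s - 1)" using that by (simp add: powr_mult_base)
    also have "\<dots> < z * (x + y) powr (s - 1)"
      using that assms by (intro mult_strict_left_mono powr_less_mono2) auto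
    finally show ?thesis .
  qed
  from this[of x] this[of y] assms
  have "x powr s + y powr s < (x + y) * (x + y) powr (s - 1)"
    by (simp add: distrib_right)
  then show ?thesis using assms by (simp add: powr_mult_base)
qed

text \<open>The same splitting, where s - 1 < 0 reverses the comparison.\<close>

lemma powr_subadditive:
  fixes s x y :: real
  assumes "s < 1" "0 < x" "0 < y"
  shows "(x + y) powr s < x powr s + y powr s"
proof -
  have "z * (x + y) powr (s - 1) < z powr s" if "0 < z" "z < x + y" for z
  proof -
    have "z * (x + y) powr (s - 1) < z * z powr (s - 1)"
      using that assms by (intro mult_strict_left_mono powr_less_mono2_neg) auto
    also have "\<dots> = z powr s" using that by (simp add: powr_mult_base)
    finally show ?thesis .
  qed
  from this[of x] this[of y] assms
  have "(x + y) * (x + y) powr (s - 1) < x powr s + y powr s"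
    by (simp add: distrib_right)
  then show ?thesis using assms by (simp add: powr_mult_base)
qed

text \<open>The failure of the parallelogram law for p-th powers; it vanishes identically for p =
  2.\<close>

definition clarkson_defect :: "real \<Rightarrow> real \<Rightarrow> real \<Rightarrow> real" where
  "clarkson_defect p a b =
     \<bar>a + b\<bar> powr p + \<bar>a - b\<bar> powr p - 2 * \<bar>a\<bar> powr p - 2 * \<bar>b\<bar> powr p"

text \<open>Passing to squares turns the threshold p = 2 into the exponent 1, where powers change
  from concave to convex.\<close>

lemma abs_powr_eq_square_powr: "\<bar>a\<bar> powr p = (a\<^sup>2) powr (p / 2)" for a p :: real
proof -
  have "(a\<^sup>2) powr (p / 2) = (\<bar>a\<bar> powr 2) powr (p / 2)" by simp
  then show ?thesis unfolding powr_powr by simp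
qed

lemma clarkson_defect_zero: "clarkson_defect p a 0 = 0" "clarkson_defect p 0 b = 0"
  by (simp_all add: clarkson_defect_def)

text \<open>Strict superadditivity at the squares of a and b, then the parallelogram identity, then
  midpoint convexity, all with exponent p/2 > 1. Strictness comes from the first step, where both
  squares must be positive.\<close>

lemma clarkson_defect_pos:
  assumes "2 < p" "a \<noteq> 0" "b \<noteq> 0"
  shows "0 < clarkson_defect p a b"
proof -
  have "2 * ((a\<^sup>2) powr (p / 2) + (b\<^sup>2) powr (p / 2)) < 2 * (a\<^sup>2 + b\<^sup>2) powr (p / 2)"
    using assms powr_superadditive[of "p / 2" "a\<^sup>2" "b\<^sup>2"] by simp
  also have "(a\<^sup>2 + b\<^sup>2) = ((a + b)\<^sup>2 + (a - b)\<^sup>2) / 2"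
    by (simp add: power2_sum power2_diff)
  also have "2 * \<dots> powr (p / 2) \<le> ((a + b)\<^sup>2) powr (p / 2) + ((a - b)\<^sup>2) powr (p / 2)"
    using assms by (intro powr_midpoint_le) auto
  finally show ?thesis
    by (simp add: clarkson_defect_def abs_powr_eq_square_powr[of _ p])
qed

lemma clarkson_defect_neg:
  assumes "0 < p" "p < 2" "a \<noteq> 0" "b \<noteq> 0"
  shows "clarkson_defect p a b < 0"
proof -
  have "((a + b)\<^sup>2) powr (p / 2) + ((a - b)\<^sup>2) powr (p / 2)
      \<le> 2 * (((a + b)\<^sup>2 + (a - b)\<^sup>2) / 2) powr (p / 2)"
    using assms by (intro powr_midpoint_ge) auto
  also have "((a + b)\<^sup>2 + (a - b)\<^sup>2) / 2 = a\<^sup>2 + b\<^sup>2"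
    by (simp add: power2_sum power2_diff)
  also have "2 * \<dots> powr (p / 2) < 2 * ((a\<^sup>2) powr (p / 2) + (b\<^sup>2) powr (p / 2))"
    using assms powr_subadditive[of "p / 2" "a\<^sup>2" "b\<^sup>2"] by simp
  finally show ?thesis
    by (simp add: clarkson_defect_def abs_powr_eq_square_powr[of _ p])
qed

text \<open>For fixed p all summands have the same sign, so each of them vanishes, and strictness
  leaves a zero argument in each.\<close>

lemma sum_clarkson_defect_eq_0_imp:
  fixes x y :: "real ^ 'n"
  assumes "0 < p" "p \<noteq> 2" and sum0: "(\<Sum>k\<in>UNIV. clarkson_defect p (x $ k) (y $ k)) = 0"
  shows "x $ k = 0 \<or> y $ k = 0"
proof (cases "2 < p")
  case True
  have "\<forall>k\<in>UNIV. 0 \<le> clarkson_defect p (x $ k) (y $ k)"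
    using clarkson_defect_pos[OF True] clarkson_defect_zero by (metis less_eq_real_def)
  then have "clarkson_defect p (x $ k) (y $ k) = 0"
    using sum0 by (simp add: sum_nonneg_eq_0_iff)
  then show ?thesis using clarkson_defect_pos[OF True] by force
next
  case False
  then have p: "p < 2" using \<open>p \<noteq> 2\<close> by simp
  have "\<forall>k\<in>UNIV. 0 \<le> - clarkson_defect p (x $ k) (y $ k)"
    using clarkson_defect_neg[OF \<open>0 < p\<close> p] clarkson_defect_zero
    by (metis less_eq_real_def neg_0_le_iff_le)
  then have "- clarkson_defect p (x $ k) (y $ k) = 0"
    using sum0 sum_nonneg_eq_0_iff[of UNIV "\<lambda>k. - clarkson_defect p (x $ k) (y $ k)"]
    by (simp add: sum_negf)
  then show ?thesis using clarkson_defect_neg[OF \<open>0 < p\<close> p] by force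
qed

section \<open>The identity is an isolated isometry for \<open>p \<noteq> 2\<close>\<close>

lemma lp_norm_nonneg: "0 \<le> lp_norm p x"
  by (simp add: lp_norm_def)

lemma lp_norm_powr: "0 < p \<Longrightarrow> lp_norm p x powr p = (\<Sum>k\<in>UNIV. \<bar>x $ k\<bar> powr p)"
  by (simp add: lp_norm_def powr_powr sum_nonneg)

lemma abs_component_le_lp_norm:
  assumes "0 < p"
  shows "\<bar>x $ k\<bar> \<le> lp_norm p x"
proof -
  have "\<bar>x $ k\<bar> powr p \<le> (\<Sum>k\<in>UNIV. \<bar>x $ k\<bar> powr p)"
    by (rule member_le_sum) auto
  then have "(\<bar>x $ k\<bar> powr p) powr (1 / p) \<le> lp_norm p x"
    unfolding lp_norm_def using assms by (intro powr_mono2) auto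
  then show ?thesis using assms by (simp add: powr_powr)
qed

lemma lp_norm_le_component_bound:
  fixes x :: "real ^ 'n"
  assumes "0 < p" "\<And>k. \<bar>x $ k\<bar> \<le> c"
  shows "lp_norm p x \<le> real CARD('n) powr (1 / p) * c"
proof -
  have c: "0 \<le> c" using assms(2) abs_ge_zero order_trans by blast
  have "(\<Sum>k\<in>UNIV. \<bar>x $ k\<bar> powr p) \<le> real CARD('n) * c powr p"
    using assms by (intro sum_bounded_above powr_mono2) auto
  then have "lp_norm p x \<le> (real CARD('n) * c powr p) powr (1 / p)"
    unfolding lp_norm_def using assms by (intro powr_mono2 sum_nonneg) auto
  then show ?thesis using assms c by (simp add: powr_mult powr_powr)
qed

lemma lp_norm_axis:
  assumes "0 < p"
  shows "lp_norm p (axis i c :: real ^ 'n) = \<bar>c\<bar>"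
proof -
  have "(\<Sum>k\<in>UNIV. \<bar>(axis i c :: real ^ 'n) $ k\<bar> powr p) = (\<Sum>k\<in>UNIV. if k = i then \<bar>c\<bar> powr p else 0)"
    by (intro sum.cong) (auto simp: axis_def)
  then show ?thesis using assms by (simp add: lp_norm_def powr_powr)
qed

text \<open>The summed defect of two vectors is a combination of p-th powers of norms, so a linear
  isometry preserves it; for two distinct basis vectors it is 0.\<close>

lemma lp_isometry_disjoint_columns:
  fixes A :: "real ^ 'n \<Rightarrow> real ^ 'n"
  assumes p: "0 < p" "p \<noteq> 2" and A: "isometry_on_space (lp_norm p) A" and "i \<noteq> j"
  shows "A (axis i 1) $ k = 0 \<or> A (axis j 1) $ k = 0"
proof -
  let ?D = "\<lambda>x y :: real ^ 'n. \<Sum>k\<in>UNIV. clarkson_defect p (x $ k) (y $ k)"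
  let ?x = "axis i 1 :: real ^ 'n" and ?y = "axis j 1 :: real ^ 'n"
  have D: "?D x y = lp_norm p (x + y) powr p + lp_norm p (x - y) powr p
      - 2 * lp_norm p x powr p - 2 * lp_norm p y powr p" for x y
    by (simp add: lp_norm_powr[OF p(1)] clarkson_defect_def sum.distrib sum_subtractf sum_distrib_left)
  have "linear A" and N: "\<And>x. lp_norm p (A x) = lp_norm p x"
    using A by (auto simp: isometry_on_space_def)
  then have "?D (A ?x) (A ?y) = ?D ?x ?y"
    unfolding D by (simp flip: linear_add linear_diff)
  also have "\<dots> = 0"
    using \<open>i \<noteq> j\<close> by (intro sum.neutral) (auto simp: axis_def clarkson_defect_zero)
  finally show ?thesis by (rule sum_clarkson_defect_eq_0_imp[OF p])
qed

text \<open>A real \<open>SUP\<close> dominates its members only when they are bounded; the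
  coordinatewise hypothesis supplies the bound n^(1/p) K.\<close>

lemma lp_operator_norm_upper:
  fixes B :: "real ^ 'n \<Rightarrow> real ^ 'n"
  assumes "0 < p" and B: "\<And>x k. \<bar>B x $ k\<bar> \<le> K * lp_norm p x"
  shows "lp_norm p (B x) / lp_norm p x \<le> operator_norm (lp_norm p) B"
  unfolding operator_norm_def
proof (rule cSUP_upper)
  \<comment> \<open>Any basis vector has norm 1, which gives the sign of K. The sign matters where
    the norm vanishes and the quotient is 0 by convention.\<close>
  have "0 \<le> K"
    using B[of "axis undefined 1" undefined] abs_ge_zero order_trans
    by (fastforce simp: lp_norm_axis[OF \<open>0 < p\<close>])
  show "bdd_above (range (\<lambda>x. lp_norm p (B x) / lp_norm p x))"
  proof (rule bdd_aboveI2)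
    fix x
    have "lp_norm p (B x) \<le> real CARD('n) powr (1 / p) * (K * lp_norm p x)"
      using assms by (intro lp_norm_le_component_bound)
    then show "lp_norm p (B x) / lp_norm p x \<le> real CARD('n) powr (1 / p) * K"
      using lp_norm_nonneg[of p x] \<open>0 \<le> K\<close>
      by (cases "lp_norm p x = 0") (auto simp: divide_simps)
  qed
qed simp

lemma lp_isometry_near_id_eq_id:
  fixes A :: "real ^ 'n \<Rightarrow> real ^ 'n"
  assumes p: "0 < p" "p \<noteq> 2" and A: "isometry_on_space (lp_norm p) A"
    and near: "operator_norm (lp_norm p) (\<lambda>x. x - A x) < 1"
  shows "A = (\<lambda>x. x)"
proof -
  have "linear A" and N: "\<And>x. lp_norm p (A x) = lp_norm p x"
    using A by (auto simp: isometry_on_space_def)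
  \<comment> \<open>Each of x and \<open>A x\<close> contributes one copy of the norm.\<close>
  have bound: "\<bar>(x - A x) $ k\<bar> \<le> 2 * lp_norm p x" for x k
    using abs_component_le_lp_norm[OF p(1), of x k] abs_component_le_lp_norm[OF p(1), of "A x" k] N[of x]
    by simp
  \<comment> \<open>The radius 1 suffices because a diagonal entry at distance less than 1 from 1 is
    positive.\<close>
  have diag_pos: "0 < A (axis k 1) $ k" for k
  proof -
    let ?x = "axis k 1 :: real ^ 'n"
    have "lp_norm p (?x - A ?x) < 1"
      using lp_operator_norm_upper[OF p(1) bound, of ?x] near by (simp add: lp_norm_axis[OF p(1)])
    then have "\<bar>(?x - A ?x) $ k\<bar> < 1"
      using abs_component_le_lp_norm[OF p(1)] le_less_trans by blast
    then show ?thesis by (simp add: axis_def)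
  qed
  \<comment> \<open>Column k already occupies row k, so disjoint supports clear that row in every
    other column.\<close>
  have off: "A (axis j 1) $ k = 0" if "k \<noteq> j" for j k
    using lp_isometry_disjoint_columns[OF p A that, of k] diag_pos[of k] by simp
  have diag: "A (axis k 1) = axis k 1" for k
  proof -
    have eq: "A (axis k 1) = axis k (A (axis k 1) $ k)"
      using off by (auto simp: vec_eq_iff axis_def)
    have "lp_norm p (A (axis k 1)) = A (axis k 1) $ k"
      using lp_norm_axis[OF p(1), of k "A (axis k 1) $ k"] diag_pos[of k] by (simp flip: eq)
    then have "A (axis k 1) $ k = 1"
      by (simp add: N lp_norm_axis[OF p(1)])
    then show ?thesis using eq by simp
  qed
  have "A = id"
    using \<open>linear A\<close> by (rule linear_eq_stdbasis) (auto simp: linear_id diag Basis_vec_def)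
  then show ?thesis by (simp add: id_def)
qed

section \<open>Rotations of a coordinate plane\<close>

definition plane_rotation :: "'n \<Rightarrow> 'n \<Rightarrow> real \<Rightarrow> real ^ 'n \<Rightarrow> real ^ 'n" where
  "plane_rotation i j \<theta> x =
     (\<chi> k. if k = i then cos \<theta> * x $ i - sin \<theta> * x $ j
           else if k = j then sin \<theta> * x $ i + cos \<theta> * x $ j else x $ k)"

lemma linear_plane_rotation: "linear (plane_rotation i j \<theta>)"
  by (rule linearI) (auto simp: plane_rotation_def vec_eq_iff algebra_simps)

lemma power2_norm_vec: "(norm x)\<^sup>2 = (\<Sum>k\<in>UNIV. (x $ k)\<^sup>2)" for x :: "real ^ 'n"
  by (simp add: norm_vec_def L2_set_def sum_nonneg)

text \<open>Isolates the rotated plane; the other coordinates are fixed by the rotation.\<close>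

lemma power2_norm_vec_split:
  fixes x :: "real ^ 'n"
  assumes "i \<noteq> j"
  shows "(norm x)\<^sup>2 = (x $ i)\<^sup>2 + (x $ j)\<^sup>2 + (\<Sum>k\<in>UNIV - {i} - {j}. (x $ k)\<^sup>2)"
  using assms by (simp add: power2_norm_vec sum.remove[of UNIV i] sum.remove[of "UNIV - {i}" j])

lemma norm_plane_rotation:
  fixes x :: "real ^ 'n"
  assumes "i \<noteq> j"
  shows "norm (plane_rotation i j \<theta> x) = norm x"
proof -
  have "(c * a - s * b)\<^sup>2 + (s * a + c * b)\<^sup>2 = (s\<^sup>2 + c\<^sup>2) * (a\<^sup>2 + b\<^sup>2)" for a b c s :: real
    by algebra
  then have "(norm (plane_rotation i j \<theta> x))\<^sup>2 = (norm x)\<^sup>2"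
    using assms by (simp add: power2_norm_vec_split plane_rotation_def)
  then show ?thesis by simp
qed

text \<open>A chord of angle \<theta> in the unit circle has length 2 |sin(\<theta>/2)| \<le>
  |\<theta>|, and only the plane component of x moves.\<close>

lemma norm_diff_plane_rotation_le:
  fixes x :: "real ^ 'n"
  assumes "i \<noteq> j"
  shows "norm (x - plane_rotation i j \<theta> x) \<le> \<bar>\<theta>\<bar> * norm x"
proof -
  have id: "(a - (c * a - s * b))\<^sup>2 + (b - (s * a + c * b))\<^sup>2 = (2 - 2 * c) * (a\<^sup>2 + b\<^sup>2)"
    if "s\<^sup>2 + c\<^sup>2 = 1" for a b c s :: real
    using that by algebra
  have "2 - 2 * cos \<theta> = (2 * sin (\<theta> / 2))\<^sup>2"
    using cos_double_sin[of "\<theta> / 2"] by (simp add: power_mult_distrib)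
  also have "\<dots> \<le> \<theta>\<^sup>2"
    using abs_sin_x_le_abs_x[of "\<theta> / 2"] by (intro abs_le_square_iff[THEN iffD1]) (simp add: abs_mult)
  finally have cos: "2 - 2 * cos \<theta> \<le> \<theta>\<^sup>2" .
  have "(norm (x - plane_rotation i j \<theta> x))\<^sup>2 = (2 - 2 * cos \<theta>) * ((x $ i)\<^sup>2 + (x $ j)\<^sup>2)"
    using assms id[of "sin \<theta>" "cos \<theta>" "x $ i" "x $ j"]
    by (simp add: power2_norm_vec_split plane_rotation_def)
  also have "\<dots> \<le> \<theta>\<^sup>2 * (norm x)\<^sup>2"
    using assms cos by (intro mult_mono) (auto simp: power2_norm_vec_split sum_nonneg)
  finally have "(norm (x - plane_rotation i j \<theta> x))\<^sup>2 \<le> (\<bar>\<theta>\<bar> * norm x)\<^sup>2"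
    by (simp add: power_mult_distrib)
  then show ?thesis by (rule power2_le_imp_le) simp
qed

section \<open>Isometries and uniform BPB approximation\<close>

text \<open>Every quotient is 1, or 0 where N vanishes; the vector a ensures that 1 occurs.\<close>

lemma isometry_in_operator_sphere:
  assumes "isometry_on_space N T" "N a \<noteq> 0"
  shows "T \<in> operator_sphere N"
proof -
  have N: "\<And>x. N (T x) = N x" and "linear T"
    using assms by (auto simp: isometry_on_space_def)
  have "operator_norm N T = 1"
    unfolding operator_norm_def
  proof (rule cSup_eq_maximum)
    show "1 \<in> range (\<lambda>x. N (T x) / N x)"
      using assms(2) N by (intro image_eqI[of _ _ a]) auto
  qed (auto simp: N)
  moreover have "bounded_operator N T"
    unfolding bounded_operator_def using \<open>linear T\<close> N by (auto intro!: exI[of _ 1])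
  ultimately show ?thesis by (simp add: operator_sphere_def)
qed

lemma isometry_uniform_BPB_approx:
  assumes T: "isometry_on_space N T" and A: "isometry_on_space N A"
    and "N a \<noteq> 0" "N 0 = 0"
    and "operator_norm N (\<lambda>x. T x - A x) < \<epsilon>" "0 < \<epsilon>"
  shows "uniform_BPB_approx N \<epsilon> T A"
proof -
  have TA: "T \<in> operator_sphere N" "A \<in> operator_sphere N"
    using assms isometry_in_operator_sphere by blast+
  then have "norm_attainment_set N A = unit_sphere N"
    using A by (auto simp: norm_attainment_set_def operator_sphere_def unit_sphere_def isometry_on_space_def)
  then show ?thesis
    \<comment> \<open>Each point of the sphere serves as its own approximant, at distance
      \<open>N 0 = 0\<close>, so \<delta> is arbitrary and 1 is taken.\<close>
    unfolding uniform_BPB_approx_def using assms TA by (auto intro!: exI[of _ 1] bexI)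
qed

lemma lp_norm_2: "lp_norm 2 = norm"
  by (rule ext) (simp add: lp_norm_def norm_vec_def L2_set_def powr_half_sqrt sum_nonneg)

lemma operator_norm_norm: "operator_norm norm A = onorm A"
  by (simp add: operator_norm_def onorm_def)

lemma euclidean_isometry_has_approx:
  fixes T :: "real ^ 'n \<Rightarrow> real ^ 'n"
  assumes T: "isometry_on_space norm T" and "0 < \<epsilon>" and "2 \<le> CARD('n)"
  shows "\<exists>A. nontrivial_uniform_BPB_approx norm \<epsilon> T A \<and> isometry_on_space norm A"
proof -
  obtain i j :: 'n where "i \<noteq> j"
    using assms(3) by (metis card_2_iff' ex_card)
  \<comment> \<open>Halving \<epsilon> makes the distance bound strict; the cap 1 < \<pi> keeps sin
    \<theta> positive.\<close>
  define \<theta> where "\<theta> = min (\<epsilon> / 2) 1"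
  have \<theta>: "0 < \<theta>" "\<theta> < \<epsilon>" "\<theta> \<le> 1" using \<open>0 < \<epsilon>\<close> by (auto simp: \<theta>_def)
  define A where "A = (\<lambda>x. T (plane_rotation i j \<theta> x))"
  have "linear T" and N: "\<And>x. norm (T x) = norm x"
    using T by (auto simp: isometry_on_space_def)
  have A: "isometry_on_space norm A"
    unfolding isometry_on_space_def A_def
    using linear_compose[OF linear_plane_rotation \<open>linear T\<close>, of i j \<theta>] \<open>i \<noteq> j\<close>
    by (auto simp: o_def N norm_plane_rotation)
  \<comment> \<open>As the rotation acts first, T can be pulled out and drops from the norm.\<close>
  have diff: "T x - A x = T (x - plane_rotation i j \<theta> x)" for x
    by (simp add: A_def linear_diff[OF \<open>linear T\<close>])
  have "operator_norm norm (\<lambda>x. T x - A x) \<le> \<theta>"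
    unfolding operator_norm_norm diff N
    by (rule onorm_le) (use norm_diff_plane_rotation_le[OF \<open>i \<noteq> j\<close>, of _ \<theta>] \<theta> in \<open>simp add: N\<close>)
  then have "uniform_BPB_approx norm \<epsilon> T A"
    using T A \<theta> by (intro isometry_uniform_BPB_approx[where a = "axis i 1"]) auto
  moreover have "A \<noteq> T"
  proof
    assume "A = T"
    then have "norm (axis i 1 - plane_rotation i j \<theta> (axis i 1)) = 0"
      using diff[of "axis i 1"] N by (metis diff_self norm_zero)
    \<comment> \<open>The coordinate j of the rotated vector is sin \<theta>, that of the original
      is 0.\<close>
    then have "plane_rotation i j \<theta> (axis i 1) $ j = (axis i 1 :: real ^ 'n) $ j" by simp
    then have "sin \<theta> = 0" using \<open>i \<noteq> j\<close> by (simp add: plane_rotation_def axis_def)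
    moreover have "0 < sin \<theta>" using \<theta> pi_gt3 by (intro sin_gt_zero) auto
    ultimately show False by simp
  qed
  ultimately show ?thesis using A by (auto simp: nontrivial_uniform_BPB_approx_def)
qed

text \<open>In dimension 1 the only isometries are the identity and its negative, at distance 2, so
  the equivalence fails at p = 2; hence the bound on the dimension.\<close>

theorem theorem5p5:
  fixes p :: real
  assumes "1 < p"
    and "2 \<le> CARD('n::finite)"
  shows "p = 2 \<longleftrightarrow>
    (\<forall>\<epsilon>>0. \<forall>T :: real ^ 'n \<Rightarrow> real ^ 'n. isometry_on_space (lp_norm p) T \<longrightarrow>
      (\<exists>A. nontrivial_uniform_BPB_approx (lp_norm p) \<epsilon> T A \<and> isometry_on_space (lp_norm p) A))"
proof
  assume "p = 2"
  then show "\<forall>\<epsilon>>0. \<forall>T :: real ^ 'n \<Rightarrow> real ^ 'n. isometry_on_space (lp_norm p) T \<longrightarrow>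
      (\<exists>A. nontrivial_uniform_BPB_approx (lp_norm p) \<epsilon> T A \<and> isometry_on_space (lp_norm p) A)"
    using euclidean_isometry_has_approx[OF _ _ assms(2)] by (simp add: lp_norm_2)
next
  assume approx: "\<forall>\<epsilon>>0. \<forall>T :: real ^ 'n \<Rightarrow> real ^ 'n. isometry_on_space (lp_norm p) T \<longrightarrow>
      (\<exists>A. nontrivial_uniform_BPB_approx (lp_norm p) \<epsilon> T A \<and> isometry_on_space (lp_norm p) A)"
  have "isometry_on_space (lp_norm p) (\<lambda>x :: real ^ 'n. x)"
    by (simp add: isometry_on_space_def linear_ident)
  \<comment> \<open>One instance decides the converse: the identity with \<epsilon> = 1, the radius
    in \<open>lp_isometry_near_id_eq_id\<close>.\<close>
  with approx obtain A :: "real ^ 'n \<Rightarrow> real ^ 'n"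
    where "nontrivial_uniform_BPB_approx (lp_norm p) 1 (\<lambda>x. x) A"
      and A: "isometry_on_space (lp_norm p) A"
    using zero_less_one by blast
  then have "operator_norm (lp_norm p) (\<lambda>x. x - A x) < 1" "A \<noteq> (\<lambda>x. x)"
    by (auto simp: nontrivial_uniform_BPB_approx_def uniform_BPB_approx_def)
  then show "p = 2"
    using lp_isometry_near_id_eq_id[OF _ _ A] assms(1) by fastforce
qed

end
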